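(* Let $A$ be an $m\times m$ real matrix of rank $r$ and let $1\le n\le m$. Assume that the vectors $\mathbf{y}_1,\ldots,\mathbf{y}_n\in\mathbb{R}^m$ are orthonormal, define $\mathbf{x}_i:=A\mathbf{y}_i$ for $i=1,\ldots,n$, and let $\mathbb{Y}_n:=\mathrm{span}\{\mathbf{y}_1,\ldots,\mathbf{y}_n\}$. Then $$\Big\|A-\sum_{i=1}^n\mathbf{x}_i\mathbf{y}_i^T\Big\| = E(\mathcal{A}_T,\mathbb{Y}_n).$$ Consequently, if $n<r$ and the singular values of $A$ satisfy $\sigma_n>\sigma_{n+1}>\sigma_{n+2}\ge 0$, the matrix $\sum_{i=1}^n\mathbf{x}_i\mathbf{y}_i^T$ is a best rank-$n$ approximation to $A$ if and only if the subspace $\mathbb{Y}_n$ is optimal for $\mathcal{A}_T$.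
   Context: $\|\cdot\|$ denotes the Euclidean norm on $\mathbb{R}^m$ and the induced operator (spectral) norm on matrices. The singular values of $A$ are $\sigma_1\ge\cdots\ge\sigma_r>\sigma_{r+1}=\cdots=\sigma_m=0$, with the convention $\sigma_{m+1}:=0$. Set $\mathcal{A}_T:=\{A^T\mathbf{x}:\mathbf{x}\in\mathbb{R}^m,\ \|\mathbf{x}\|\le1\}$. For a subspace $\mathbb{Y}$ of $\mathbb{R}^m$, $E(\mathcal{A}_T,\mathbb{Y}):=\max_{\mathbf{a}\in\mathcal{A}_T}\min_{\mathbf{y}\in\mathbb{Y}}\|\mathbf{a}-\mathbf{y}\|$. The Kolmogorov $n$-width is $d_n(\mathcal{A}_T):=\min_{\mathbb{Y}_n}E(\mathcal{A}_T,\mathbb{Y}_n)$, the minimum being over all $n$-dimensional subspaces $\mathbb{Y}_n$ of $\mathbb{R}^m$; an $n$-dimensional subspace $\mathbb{Y}_n$ is called optimal for $\mathcal{A}_T$ if $E(\mathcal{A}_T,\mathbb{Y}_n)=d_n(\mathcal{A}_T)$. For $n<r$, a best rank-$n$ approximation to $A$ is an $m\times m$ real matrix $R_n$ of rank $n$ such that $\|A-R_n\|\le\|A-B\|$ for every $m\times m$ real matrix $B$ of rank $n$. *)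

theory Defs
  imports "HOL-Analysis.Analysis" "HOL-Computational_Algebra.Polynomial"
begin

definition outer_product :: "real^'m \<Rightarrow> real^'m \<Rightarrow> real^'m^'m" where
  "outer_product x y = (\<chi> i j. x $ i * y $ j)"

definition char_polynomial :: "real^'m^'m \<Rightarrow> real poly" where
  "char_polynomial M = det (\<chi> i j. (if i = j then [:0, 1:] else 0) - [:M $ i $ j:])"

text \<open>
  The singular values are the square roots of the eigenvalues of \<open>A\<^sup>T A\<close>, counted with
  algebraic multiplicity. Since \<open>A\<^sup>T A\<close> is symmetric, its characteristic polynomial splits over
  the reals, so there are exactly \<open>CARD('m)\<close> of them.
\<close>

definition singular_values :: "real^'m^'m \<Rightarrow> real multiset" where
  "singular_values A = image_mset sqrt (proots (char_polynomial (transpose A ** A)))"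

text \<open>
  \<open>singular_value A k\<close> is the \<open>k\<close>-th largest singular value, for \<open>k = 1, \<dots>, CARD('m)\<close>; it is
  \<open>0\<close> for larger \<open>k\<close>, in particular for \<open>k = CARD('m) + 1\<close>.
\<close>

definition singular_value :: "real^'m^'m \<Rightarrow> nat \<Rightarrow> real" where
  "singular_value A k =
     (let s = rev (sorted_list_of_multiset (singular_values A))
      in if 1 \<le> k \<and> k \<le> length s then s ! (k - 1) else 0)"

definition ball_image_transpose :: "real^'m^'m \<Rightarrow> (real^'m) set" where
  "ball_image_transpose A = {transpose A *v x | x. norm x \<le> 1}"

text \<open>
  The supremum and the infimum below are a maximum and a minimum whenever \<open>Y\<close> is a subspace;
  see \<open>deviation_inf_attained\<close> and \<open>deviation_sup_attained\<close>.
\<close>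

definition deviation :: "(real^'m) set \<Rightarrow> (real^'m) set \<Rightarrow> real" where
  "deviation S Y = (SUP a\<in>S. INF y\<in>Y. norm (a - y))"

text \<open>
  The minimum over all \<open>n\<close>-dimensional subspaces is written as an infimum; it is meaningful for
  \<open>n \<le> CARD('m)\<close> only, since otherwise there are no such subspaces.
\<close>

definition kolmogorov_width :: "nat \<Rightarrow> (real^'m) set \<Rightarrow> real" where
  "kolmogorov_width n S = (INF Y\<in>{Y. subspace Y \<and> dim Y = n}. deviation S Y)"

definition optimal_subspace :: "nat \<Rightarrow> (real^'m) set \<Rightarrow> (real^'m) set \<Rightarrow> bool" where
  "optimal_subspace n S Y \<longleftrightarrow>
     subspace Y \<and> dim Y = n \<and> deviation S Y = kolmogorov_width n S"

definition best_rank_approx :: "nat \<Rightarrow> real^'m^'m \<Rightarrow> real^'m^'m \<Rightarrow> bool" where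
  "best_rank_approx n A R \<longleftrightarrow>
     rank R = n \<and>
     (\<forall>B :: real^'m^'m. rank B = n \<longrightarrow> onorm ((*v) (A - R)) \<le> onorm ((*v) (A - B)))"

lemma deviation_inf_attained:
  fixes a :: "real^'m"
  assumes "subspace Y"
  shows "\<exists>y\<in>Y. (INF y\<in>Y. norm (a - y)) = norm (a - y) \<and> (\<forall>z\<in>Y. norm (a - y) \<le> norm (a - z))"
proof -
  have ne: "Y \<noteq> {}" using assms subspace_0 by blast
  obtain y where y: "y \<in> Y" "infdist a Y = dist a y"
    using infdist_attains_inf[OF closed_subspace[OF assms] ne] by metis
  have "(INF y\<in>Y. norm (a - y)) = norm (a - y)"
    using y ne by (simp add: infdist_notempty dist_norm)
  moreover have "norm (a - y) \<le> norm (a - z)" if "z \<in> Y" for z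
    using infdist_le[OF that, of a] y(2) by (simp add: dist_norm)
  ultimately show ?thesis using y(1) by blast
qed

lemma deviation_sup_attained:
  fixes A :: "real^'m^'m"
  assumes "subspace Y"
  shows "\<exists>a\<in>ball_image_transpose A.
           deviation (ball_image_transpose A) Y = (INF y\<in>Y. norm (a - y)) \<and>
           (\<forall>b\<in>ball_image_transpose A. (INF y\<in>Y. norm (b - y)) \<le> (INF y\<in>Y. norm (a - y)))"
proof -
  let ?S = "ball_image_transpose A"
  have ne: "Y \<noteq> {}" using assms subspace_0 by blast
  have S: "?S = (*v) (transpose A) ` cball 0 1"
    by (auto simp: ball_image_transpose_def)
  have "compact ?S" unfolding S
    by (intro compact_continuous_image linear_continuous_on matrix_vector_mul_bounded_linear) simp
  moreover have "?S \<noteq> {}" unfolding S by simp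
  moreover have "continuous_on ?S (\<lambda>a. infdist a Y)"
    by (intro continuous_on_infdist continuous_on_id)
  ultimately obtain a where a: "a \<in> ?S" "\<forall>b\<in>?S. infdist b Y \<le> infdist a Y"
    using continuous_attains_sup by blast
  have inf: "(INF y\<in>Y. norm (b - y)) = infdist b Y" for b
    using ne by (simp add: infdist_notempty dist_norm)
  have "(SUP a\<in>?S. infdist a Y) = infdist a Y"
    using a by (intro cSup_eq_maximum) auto
  then show ?thesis using a unfolding deviation_def inf by blast
qed

end

theory Submission
  imports Defs
begin

text \<open>
  If \<open>P\<close> is the orthogonal projection onto \<open>Y\<close>, then the approximating matrix is \<open>A P\<close>, and both
  the error norm and the deviation equal the norm of \<open>A\<close> restricted to the orthogonal complement
  of \<open>Y\<close>. For \<open>B\<close> of rank \<open>n\<close> with row space \<open>Z\<close>, \<open>A\<close> and \<open>A - B\<close> agree on the complement of \<open>Z\<close>, so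
  the deviation of \<open>Z\<close> is at most \<open>\<parallel>A - B\<parallel>\<close>. Hence an optimal subspace yields a minimal error, and the
  gap \<open>\<sigma>\<^sub>n > \<sigma>\<^sub>n\<^sub>+\<^sub>1\<close> is needed only to show that \<open>A P\<close> has rank exactly \<open>n\<close>. Conversely, by
  dimension counting against the span of leading right singular vectors, every \<open>n\<close>-dimensional
  subspace has deviation at least \<open>\<sigma>\<^sub>n\<^sub>+\<^sub>1\<close>. The span of the first \<open>n\<close> of these vectors attains this
  bound, and its projected matrix has rank \<open>n\<close>, so a best approximation cannot do worse.
\<close>

section \<open>Spectral theorem for self-adjoint maps on an invariant subspace\<close>

text \<open>By induction on the dimension: a maximiser \<open>v\<close> of the quadratic form on the
  unit sphere of \<open>V\<close> is an eigenvector, and symmetry makes its complement in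
  \<open>V\<close> invariant, so the argument repeats there.\<close>

lemma self_adjoint_orthonormal_eigenvectors:
  fixes f :: "'a::euclidean_space \<Rightarrow> 'a"
  assumes "linear f" and sym: "\<And>u v. f u \<bullet> v = u \<bullet> f v"
    and "subspace V" "f ` V \<subseteq> V"
  shows "\<exists>B\<subseteq>V. finite B \<and> card B = dim V \<and> pairwise orthogonal B \<and>
           (\<forall>b\<in>B. norm b = 1 \<and> (\<exists>l. f b = l *\<^sub>R b))"
  using assms(3,4)
proof (induction "dim V" arbitrary: V)
  case 0
  then show ?case by (intro exI[of _ "{}"]) auto
next
  case (Suc d)
  interpret linear f by fact
  obtain u where u: "u \<in> V" "u \<noteq> 0"
    using Suc.hyps(2) Suc.prems(1) by (metis dim_eq_0 nat.simps(3) subsetI insertCI)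
  let ?S = "V \<inter> sphere 0 1"
  have "compact ?S"
    using Suc.prems(1) by (simp add: closed_Int_compact closed_subspace)
  moreover have "u /\<^sub>R norm u \<in> ?S"
    using u Suc.prems(1) by (simp add: subspace_scale)
  moreover have "continuous_on ?S (\<lambda>v. v \<bullet> f v)"
    using \<open>linear f\<close> by (intro continuous_intros linear_continuous_on linear_linear[THEN iffD2])
  ultimately obtain v where v: "v \<in> ?S" and vmax: "\<And>w. w \<in> ?S \<Longrightarrow> w \<bullet> f w \<le> v \<bullet> f v"
    by (metis (no_types, lifting) continuous_attains_sup empty_iff)
  define l where "l = v \<bullet> f v"
  have vV: "v \<in> V" and vv: "v \<bullet> v = 1"
    using v by (auto simp: dot_square_norm)
  have quad: "w \<bullet> f w \<le> l * (w \<bullet> w)" if "w \<in> V" for w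
  proof (cases "w = 0")
    case False
    have "(w /\<^sub>R norm w) \<bullet> f (w /\<^sub>R norm w) \<le> l"
      unfolding l_def using False that Suc.prems(1) by (intro vmax) (simp add: subspace_scale)
    then show ?thesis using False
      by (simp add: scale field_simps dot_square_norm power2_eq_square)
  qed (simp add: zero)
  text \<open>\<open>l \<parallel>w\<parallel>\<^sup>2 - \<langle>w, f w\<rangle>\<close> is nonnegative on \<open>V\<close> and vanishes at \<open>v\<close>,
    so its first variation \<open>2 * \<parallel>z\<parallel>\<^sup>2\<close> at \<open>v\<close> in the direction \<open>z\<close> vanishes.\<close>
  define z where "z = l *\<^sub>R v - f v"
  have zV: "z \<in> V"
    using vV Suc.prems by (auto simp: z_def intro!: subspace_diff subspace_scale)
  have "z = 0"
  proof (rule ccontr)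
    assume "z \<noteq> 0"
    then have zz: "z \<bullet> z > 0" by simp
    define q where "q = l * (z \<bullet> z) - z \<bullet> f z"
    have "q \<ge> 0" using quad[OF zV] by (simp add: q_def)
    have *: "0 \<le> - 2 * t * (z \<bullet> z) + t\<^sup>2 * q" for t :: real
    proof -
      have "v - t *\<^sub>R z \<in> V" using vV zV Suc.prems(1) by (intro subspace_diff subspace_scale)
      from quad[OF this] have "0 \<le> - 2 * t * (l * (v \<bullet> z) - f v \<bullet> z) + t\<^sup>2 * q"
        using vv sym[of v z]
        by (simp add: diff scale inner_diff_left inner_diff_right q_def l_def
            power2_eq_square algebra_simps inner_commute)
      also have "l * (v \<bullet> z) - f v \<bullet> z = z \<bullet> z"
        by (simp add: z_def inner_diff_left)
      finally show ?thesis .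
    qed
    have "2 * (z \<bullet> z) \<le> t * q" if "t > 0" for t
      using *[of t] that by (simp add: power2_eq_square)
    \<comment> \<open>This \<open>t\<close> turns the right side into \<open>q / (q + 1)\<close>
      times \<open>z \<bullet> z\<close>, a factor below 1; the added 1 keeps the quotient
      meaningful for \<open>q = 0\<close>.\<close>
    from this[of "(z \<bullet> z) / (q + 1)"] have "2 * (z \<bullet> z) \<le> (z \<bullet> z) * (q / (q + 1))"
      using zz \<open>q \<ge> 0\<close> by simp
    also have "\<dots> \<le> (z \<bullet> z) * 1"
      using zz \<open>q \<ge> 0\<close> by (intro mult_left_mono) auto
    finally show False using zz by simp
  qed
  then have fv: "f v = l *\<^sub>R v" by (simp add: z_def)
  define V' where "V' = {w \<in> V. \<forall>x\<in>span {v}. orthogonal x w}"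
  have V': "V' = {w \<in> V. v \<bullet> w = 0}"
    by (auto simp: V'_def span_singleton orthogonal_def)
  have "dim V' + dim (span {v}) = dim V"
    unfolding V'_def using vV Suc.prems(1)
    by (intro dim_subspace_orthogonal_to_vectors) (auto simp: span_minimal)
  moreover have "dim {v} = 1" using vv by (auto simp: dim_insert)
  ultimately have "d = dim V'" using Suc.hyps(2) by simp
  moreover have "subspace V'"
    using Suc.prems(1) by (auto simp: V' subspace_def inner_add_right)
  moreover have "f ` V' \<subseteq> V'"
    using Suc.prems(2) by (auto simp: V' fv sym[symmetric])
  ultimately obtain B where B: "B \<subseteq> V'" "finite B" "card B = dim V'" "pairwise orthogonal B"
    "\<forall>b\<in>B. norm b = 1 \<and> (\<exists>l. f b = l *\<^sub>R b)"
    using Suc.hyps(1) by metis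
  have "v \<notin> B" using B(1) vv by (auto simp: V')
  then have "card (insert v B) = dim V"
    using B \<open>d = dim V'\<close> Suc.hyps(2) by simp
  moreover have "pairwise orthogonal (insert v B)"
    using B(1,4) by (auto simp: pairwise_insert V' orthogonal_def inner_commute)
  moreover have "norm v = 1" using v by simp
  ultimately show ?case
    using B vV fv by (intro exI[of _ "insert v B"]) (auto simp: V')
qed

section \<open>Characteristic polynomial and right singular vectors\<close>

lemma poly_det:
  fixes M :: "real poly^'m^'m"
  shows "poly (det M) t = det (\<chi> i j. poly (M $ i $ j) t)"
  by (simp add: det_def poly_sum poly_prod of_int_poly)

text \<open>With the members of \<open>B\<close> as columns of \<open>Q\<close>,
  \<open>t I - M\<close> times \<open>Q\<close> is \<open>Q\<close> times a diagonal matrix.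
  Cancelling \<open>det Q\<close> gives the value at every real \<open>t\<close>, which determines
  the polynomial.\<close>

lemma char_polynomial_eq_prod:
  fixes M :: "real^'m^'m"
  assumes B: "finite B" "card B = CARD('m)" "pairwise orthogonal B" "\<And>b. b \<in> B \<Longrightarrow> norm b = 1"
    and eig: "\<And>b. b \<in> B \<Longrightarrow> M *v b = l b *\<^sub>R b"
  shows "char_polynomial M = (\<Prod>b\<in>B. [:- l b, 1:])"
proof -
  obtain g where g: "bij_betw g (UNIV :: 'm set) B"
    using B(1,2) by (metis finite_class.finite_UNIV finite_same_card_bij)
  have gB: "g i \<in> B" for i using g by (auto simp: bij_betw_def)
  define Q :: "real^'m^'m" where "Q = (\<chi> i j. g j $ i)"
  have col: "column j Q = g j" for j by (simp add: Q_def column_def)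
  have "orthogonal_matrix Q"
    unfolding orthogonal_matrix_orthonormal_columns col
  proof (intro conjI allI impI)
    show "orthogonal (g i) (g j)" if "i \<noteq> j" for i j
      using B(3) g gB that by (metis UNIV_I bij_betw_def inj_onD pairwiseD)
  qed (use B(4) gB in auto)
  then have detQ: "det Q \<noteq> 0" using det_orthogonal_matrix by fastforce
  have "poly (char_polynomial M) t = poly (\<Prod>b\<in>B. [:- l b, 1:]) t" for t
  proof -
    define N :: "real^'m^'m" where "N = t *\<^sub>R mat 1 - M"
    define D :: "real^'m^'m" where "D = (\<chi> i j. if i = j then t - l (g i) else 0)"
    have N: "N = (\<chi> i j. poly ((if i = j then [:0, 1:] else 0) - [:M $ i $ j:]) t)"
      by (simp add: N_def mat_def vec_eq_iff)
    have "(N ** Q) $ i $ j = (Q ** D) $ i $ j" for i j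
    proof -
      have "(N ** Q) $ i $ j = (N *v g j) $ i"
        by (simp add: matrix_matrix_mult_def matrix_vector_mult_def Q_def)
      also have "\<dots> = (t - l (g j)) * g j $ i"
        using eig[OF gB[of j]]
        by (simp add: N_def matrix_vector_mult_diff_rdistrib scaleR_matrix_vector_assoc[symmetric] algebra_simps)
      also have "\<dots> = (Q ** D) $ i $ j"
        by (simp add: matrix_matrix_mult_def Q_def D_def if_distrib cong: if_cong)
      finally show ?thesis .
    qed
    then have "N ** Q = Q ** D" by (simp add: vec_eq_iff)
    then have "det N * det Q = det Q * det D" by (metis det_mul)
    then have "det N = det D" using detQ by simp
    also have "\<dots> = (\<Prod>i\<in>UNIV. t - l (g i))"
      by (subst det_diagonal) (simp_all add: D_def)
    also have "\<dots> = (\<Prod>b\<in>B. t - l b)"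
      using g by (rule prod.reindex_bij_betw)
    finally show ?thesis
      by (simp add: char_polynomial_def poly_det N poly_prod)
  qed
  then show ?thesis by (simp add: poly_eq_poly_eq_iff[symmetric] fun_eq_iff)
qed

lemma inner_matrix_vector_mult:
  fixes A :: "real^'m^'m"
  shows "(A *v v) \<bullet> (A *v w) = ((transpose A ** A) *v v) \<bullet> w"
  by (metis dot_lmul_matrix matrix_vector_mul_assoc transpose_matrix_vector)

definition orthonormal_on :: "'i set \<Rightarrow> ('i \<Rightarrow> 'a::real_inner) \<Rightarrow> bool" where
  "orthonormal_on I e \<longleftrightarrow> (\<forall>i\<in>I. \<forall>j\<in>I. e i \<bullet> e j = (if i = j then 1 else 0))"

lemma orthonormal_onD:
  "orthonormal_on I e \<Longrightarrow> i \<in> I \<Longrightarrow> j \<in> I \<Longrightarrow> e i \<bullet> e j = (if i = j then 1 else 0)"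
  by (auto simp: orthonormal_on_def)

lemma orthonormal_on_subset: "orthonormal_on I e \<Longrightarrow> J \<subseteq> I \<Longrightarrow> orthonormal_on J e"
  unfolding orthonormal_on_def by blast

text \<open>Right singular vectors, numbered to match \<open>singular_value A\<close>. Later
  arguments use singular values only through these facts, never through the characteristic
  polynomial.\<close>

locale singular_basis =
  fixes A :: "real^'m^'m" and e :: "nat \<Rightarrow> real^'m"
  assumes orthonormal: "orthonormal_on {1..CARD('m)} e"
    and eigenvector:
      "\<And>i. i \<in> {1..CARD('m)} \<Longrightarrow> (transpose A ** A) *v e i = (singular_value A i)\<^sup>2 *\<^sub>R e i"
    and singular_nonneg: "\<And>i. i \<in> {1..CARD('m)} \<Longrightarrow> 0 \<le> singular_value A i"
    and singular_antimono:
      "\<And>i j. i \<in> {1..CARD('m)} \<Longrightarrow> j \<in> {i..CARD('m)} \<Longrightarrow> singular_value A j \<le> singular_value A i"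

text \<open>An orthonormal eigenbasis of \<open>transpose A ** A\<close> has eigenvalues
  \<open>l b\<close>, the squared norms of \<open>A *v b\<close>. They are the roots of the
  characteristic polynomial with multiplicity, so their square roots are the singular
  values.\<close>

lemma singular_basis_exists:
  fixes A :: "real^'m^'m"
  obtains e where "singular_basis A e"
proof -
  let ?S = "transpose A ** A" and ?m = "CARD('m)"
  have "(?S *v u) \<bullet> v = u \<bullet> (?S *v v)" for u v
    by (metis inner_commute inner_matrix_vector_mult)
  then obtain B where B: "finite B" "card B = ?m" "pairwise orthogonal B"
    and nB: "\<And>b. b \<in> B \<Longrightarrow> norm b = 1" and "\<forall>b\<in>B. \<exists>l. ?S *v b = l *\<^sub>R b"
    using self_adjoint_orthonormal_eigenvectors[of "(*v) ?S" UNIV] by auto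
  then obtain l where l: "\<And>b. b \<in> B \<Longrightarrow> ?S *v b = l b *\<^sub>R b" by metis
  have l_nonneg: "l b \<ge> 0" if "b \<in> B" for b
  proof -
    have "l b = (l b *\<^sub>R b) \<bullet> b" using nB[OF that] by (simp add: dot_square_norm)
    also have "\<dots> = (A *v b) \<bullet> (A *v b)" using l[OF that] by (simp add: inner_matrix_vector_mult)
    finally show ?thesis by simp
  qed
  obtain bs0 where bs0: "set bs0 = B" "distinct bs0" using B(1) finite_distinct_list by blast
  \<comment> \<open>Sorting the vectors by eigenvalue keeps each vector attached to its
    value.\<close>
  define bs where "bs = sort_key l bs0"
  have bs: "set bs = B" "distinct bs" "length bs = ?m" "sorted (map l bs)"
    using bs0 B(2) distinct_card[OF bs0(2)] by (auto simp: bs_def)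
  have "proots (char_polynomial ?S) = (\<Sum>b\<in>B. {#l b#})"
    by (subst char_polynomial_eq_prod[OF B nB l]) (simp_all add: proots_prod)
  also have "\<dots> = image_mset l (mset_set B)"
    using B(1) by (induction B rule: finite_induct) auto
  also have "mset_set B = mset bs" using bs(1,2) mset_set_set by blast
  finally have "singular_values A = mset (map (sqrt \<circ> l) bs)"
    by (simp add: singular_values_def image_mset.compositionality comp_def)
  moreover have "sorted (map (sqrt \<circ> l) bs)"
    using bs(4) by (simp add: sorted_map sorted_wrt_map)
  ultimately have s: "rev (sorted_list_of_multiset (singular_values A)) = map (sqrt \<circ> l) (rev bs)"
    by (simp add: sorted_sort_id rev_map del: mset_map)
  \<comment> \<open>The reversal makes \<open>e 1\<close> belong to the largest value; counted from
    zero, \<open>e k\<close> is entry \<open>CARD('m) - k\<close> of \<open>bs\<close>.\<close>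
  define e where "e k = rev bs ! (k - 1)" for k
  have eB: "e i \<in> B" if "i \<in> {1..?m}" for i
  proof -
    have "e i \<in> set (rev bs)" unfolding e_def using bs(3) that by (intro nth_mem) auto
    then show ?thesis using bs(1) by simp
  qed
  have e_inj: "e i = e j \<longleftrightarrow> i = j" if "i \<in> {1..?m}" "j \<in> {1..?m}" for i j
    unfolding e_def using that bs(2,3) by (subst nth_eq_iff_index_eq) auto
  have sv: "singular_value A i = sqrt (l (e i))" if "i \<in> {1..?m}" for i
  proof -
    have "i - 1 < length (rev bs)" using that bs(3) by auto
    then show ?thesis using that bs(3) by (simp add: singular_value_def s Let_def e_def nth_map)
  qed
  have dec: "singular_value A j \<le> singular_value A i" if "i \<in> {1..?m}" "j \<in> {i..?m}" for i j
  proof -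
    have "map l bs ! (?m - j) \<le> map l bs ! (?m - i)"
      using that bs(3,4) by (intro sorted_nth_mono) auto
    moreover have "l (e k) = map l bs ! (?m - k)" if "k \<in> {1..?m}" for k
      using that bs(3) by (auto simp: e_def rev_nth)
    moreover have "j \<in> {1..?m}" using that by auto
    ultimately show ?thesis using that by (simp add: sv)
  qed
  have orth: "e i \<bullet> e j = (if i = j then 1 else 0)" if "i \<in> {1..?m}" "j \<in> {1..?m}" for i j
  proof (cases "i = j")
    case True
    then show ?thesis using nB eB that by (simp add: dot_square_norm)
  next
    case False
    then show ?thesis
      using B(3) eB[OF that(1)] eB[OF that(2)] e_inj[OF that] by (auto simp: pairwise_def orthogonal_def)
  qed
  have "singular_basis A e"
    using orth dec l eB l_nonneg sv by unfold_locales (auto simp: orthonormal_on_def)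
  then show thesis by (rule that)
qed

section \<open>Orthonormal families and dimension counts\<close>

lemma dim_span_orthonormal:
  fixes e :: "'i \<Rightarrow> 'a::euclidean_space"
  assumes "orthonormal_on I e"
  shows "dim (span (e ` I)) = card I"
proof -
  have "inj_on e I"
    using assms unfolding inj_on_def orthonormal_on_def by (metis zero_neq_one)
  moreover have "pairwise orthogonal (e ` I)"
    using assms by (auto simp: pairwise_def orthogonal_def orthonormal_on_def)
  moreover have "0 \<notin> e ` I"
    using assms by (force simp: orthonormal_on_def)
  ultimately show ?thesis
    by (metis dim_span dim_eq_card_independent pairwise_orthogonal_independent card_image)
qed

lemma orthonormal_coefficients:
  assumes "finite I" "orthonormal_on I e" "w \<in> span (e ` I)"
  shows "w = (\<Sum>i\<in>I. (e i \<bullet> w) *\<^sub>R e i)"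
  using assms(3)
proof (induction rule: span_induct_alt)
  case (step c x y)
  then obtain j where j: "j \<in> I" "x = e j" by blast
  have "(\<Sum>i\<in>I. (e i \<bullet> (c *\<^sub>R x)) *\<^sub>R e i) = (\<Sum>i\<in>I. if i = j then c *\<^sub>R e j else 0)"
    using j assms(2) by (intro sum.cong) (auto simp: orthonormal_onD)
  also have "\<dots> = c *\<^sub>R x" using j assms(1) by simp
  finally show ?case
    using step(2) by (simp add: inner_add_right scaleR_add_left sum.distrib del: inner_scaleR_right)
qed simp

text \<open>Two families serve two purposes: \<open>f = e\<close> gives Parseval's identity, and
  \<open>f i\<close> an eigenvalue multiple of \<open>e i\<close> gives the quadratic form of
  \<open>transpose A ** A\<close>.\<close>

lemma inner_orthonormal_sums:
  assumes "finite I" and "\<And>i j. i \<in> I \<Longrightarrow> j \<in> I \<Longrightarrow> f i \<bullet> e j = (if i = j then d i else 0)"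
  shows "(\<Sum>i\<in>I. c i *\<^sub>R f i) \<bullet> (\<Sum>i\<in>I. c i *\<^sub>R e i) = (\<Sum>i\<in>I. d i * (c i)\<^sup>2)"
proof -
  have "(\<Sum>i\<in>I. c i *\<^sub>R f i) \<bullet> (\<Sum>j\<in>I. c j *\<^sub>R e j)
      = (\<Sum>i\<in>I. \<Sum>j\<in>I. if i = j then d i * (c i)\<^sup>2 else 0)"
    unfolding inner_sum_left inner_sum_right
    by (intro sum.cong) (auto simp: assms(2) power2_eq_square)
  then show ?thesis using assms(1) by simp
qed

lemma orthogonal_decomposition:
  fixes Z :: "'a::euclidean_space set"
  assumes "subspace Z"
  obtains p q where "p \<in> Z" "\<And>z. z \<in> Z \<Longrightarrow> orthogonal q z" "w = p + q"
  using orthogonal_subspace_decomp_exists[of Z w] assms by (metis span_eq_iff)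

lemma dim_orthogonal_complement:
  fixes Z :: "'a::euclidean_space set"
  assumes "subspace Z"
  shows "dim {w. \<forall>z\<in>Z. orthogonal z w} + dim Z = DIM('a)"
  using dim_subspace_orthogonal_to_vectors[OF assms subspace_UNIV] by simp

lemma subspace_nontrivial_Int:
  fixes U W :: "'a::euclidean_space set"
  assumes "subspace U" "subspace W" "DIM('a) < dim U + dim W"
  obtains w where "w \<in> U" "w \<in> W" "w \<noteq> 0"
proof -
  have "dim {x + y |x y. x \<in> U \<and> y \<in> W} \<le> DIM('a)" by (rule dim_subset_UNIV)
  with dim_sums_Int[OF assms(1,2)] assms(3) have "dim (U \<inter> W) \<noteq> 0" by linarith
  then have "\<not> U \<inter> W \<subseteq> {0}" by (simp add: dim_eq_0)
  then show thesis using that by blast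
qed

section \<open>The matrix composed with an orthogonal projection\<close>

text \<open>Kept general in the family because it is applied both to the given \<open>y\<close> and
  to the right singular vectors \<open>e\<close>.\<close>

definition projected_matrix :: "real^'m^'m \<Rightarrow> (nat \<Rightarrow> real^'m) \<Rightarrow> nat \<Rightarrow> real^'m^'m" where
  "projected_matrix A y n = (\<Sum>i=1..n. outer_product (A *v y i) (y i))"

lemma outer_product_mult: "outer_product u v *v w = (v \<bullet> w) *\<^sub>R u"
  by (simp add: vec_eq_iff outer_product_def matrix_vector_mult_def inner_vec_def sum_distrib_left algebra_simps)

lemma projected_matrix_mult:
  "projected_matrix A y n *v w = A *v (\<Sum>i=1..n. (y i \<bullet> w) *\<^sub>R y i)"
proof -
  have "(\<Sum>i\<in>I. outer_product (A *v y i) (y i)) *v w = (\<Sum>i\<in>I. (y i \<bullet> w) *\<^sub>R (A *v y i))" for I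
    by (induction I rule: infinite_finite_induct)
      (simp_all add: matrix_vector_mult_add_rdistrib outer_product_mult)
  then show ?thesis
    by (simp add: projected_matrix_def vec.sum matrix_vector_mult_scaleR)
qed

lemma projected_matrix_on_span:
  assumes "orthonormal_on {1..n} y" "w \<in> span (y ` {1..n})"
  shows "projected_matrix A y n *v w = A *v w"
  using orthonormal_coefficients[OF _ assms] by (simp add: projected_matrix_mult)

lemma projected_matrix_orthogonal:
  assumes "\<And>z. z \<in> span (y ` {1..n}) \<Longrightarrow> orthogonal z w"
  shows "projected_matrix A y n *v w = 0"
proof -
  have "y i \<bullet> w = 0" if "i \<in> {1..n}" for i
    using assms that by (auto simp: orthogonal_def span_base)
  then show ?thesis by (simp add: projected_matrix_mult)
qed

lemma range_projected_matrix:
  assumes "orthonormal_on {1..n} y"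
  shows "range ((*v) (projected_matrix A y n)) = (*v) A ` span (y ` {1..n})"
proof (intro equalityI subsetI)
  fix u assume "u \<in> range ((*v) (projected_matrix A y n))"
  then show "u \<in> (*v) A ` span (y ` {1..n})"
    unfolding projected_matrix_mult by (force intro: span_sum span_scale span_base)
next
  fix u assume "u \<in> (*v) A ` span (y ` {1..n})"
  then obtain w where "w \<in> span (y ` {1..n})" "u = A *v w" by blast
  then show "u \<in> range ((*v) (projected_matrix A y n))"
    using projected_matrix_on_span[OF assms] by (metis rangeI)
qed

text \<open>The range is the image of the span, and \<open>A\<close> is injective there, so the
  dimension \<open>n\<close> survives.\<close>

lemma rank_projected_matrix:
  fixes A :: "real^'m^'m"
  assumes "orthonormal_on {1..n} y"
    and "\<And>v. v \<in> span (y ` {1..n}) \<Longrightarrow> A *v v = 0 \<Longrightarrow> v = 0"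
  shows "rank (projected_matrix A y n) = n"
proof -
  have "inj_on ((*v) A) (span (y ` {1..n}))"
    using assms(2) linear_injective_on_subspace_0[OF matrix_vector_mul_linear subspace_span] by blast
  then have "dim ((*v) A ` span (y ` {1..n})) = dim (span (y ` {1..n}))"
    by (intro dim_image_eq matrix_vector_mul_linear) (simp add: span_span)
  then show ?thesis
    by (simp only: rank_dim_range range_projected_matrix[OF assms(1)] dim_span_orthonormal[OF assms(1)]) simp
qed

section \<open>Deviation as the norm of the matrix on an orthogonal complement\<close>

lemma deviation_eq_infdist:
  assumes "Y \<noteq> {}"
  shows "deviation (ball_image_transpose A) Y = (SUP x\<in>cball 0 1. infdist (transpose A *v x) Y)"
proof -
  have "ball_image_transpose A = (\<lambda>x. transpose A *v x) ` cball 0 1"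
    by (auto simp: ball_image_transpose_def)
  then show ?thesis
    using assms by (simp add: deviation_def infdist_notempty dist_norm image_image)
qed

text \<open>By Pythagoras, replacing \<open>p\<close> by another point of \<open>Z\<close> adds a
  component orthogonal to \<open>q\<close>, which cannot shorten the difference.\<close>

lemma infdist_subspace:
  fixes Z :: "'a::euclidean_space set"
  assumes "p \<in> Z" "subspace Z" "\<And>z. z \<in> Z \<Longrightarrow> orthogonal q z"
  shows "infdist (p + q) Z = norm q"
proof (rule antisym)
  show "infdist (p + q) Z \<le> norm q"
    using infdist_le[OF assms(1), of "p + q"] by (simp add: dist_norm)
  have "norm q \<le> dist (p + q) z" if "z \<in> Z" for z
  proof -
    have "orthogonal q (p - z)" using assms that by (simp add: subspace_diff)
    then have "(norm (q + (p - z)))\<^sup>2 = (norm q)\<^sup>2 + (norm (p - z))\<^sup>2" by (rule norm_add_Pythagorean)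
    then have "(norm q)\<^sup>2 \<le> (norm (p + q - z))\<^sup>2" by (simp add: algebra_simps)
    then show ?thesis by (simp add: dist_norm power2_le_iff_abs_le)
  qed
  then show "norm q \<le> infdist (p + q) Z"
    using assms(1) by (subst infdist_notempty) (auto intro: cINF_greatest)
qed

text \<open>Compactness of the unit ball bounds the distances, as a real supremum requires.\<close>

lemma deviation_upper:
  fixes A :: "real^'m^'m"
  assumes "subspace Z" "norm x \<le> 1"
  shows "infdist (transpose A *v x) Z \<le> deviation (ball_image_transpose A) Z"
proof -
  have "compact ((\<lambda>x. infdist (transpose A *v x) Z) ` cball 0 1)"
    by (intro compact_continuous_image continuous_on_infdist linear_continuous_on
        matrix_vector_mul_bounded_linear) simp
  then have "bdd_above ((\<lambda>x. infdist (transpose A *v x) Z) ` cball 0 1)"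
    by (intro bounded_imp_bdd_above compact_imp_bounded)
  then show ?thesis
    using assms subspace_0[OF assms(1)] by (subst deviation_eq_infdist) (auto intro: cSUP_upper)
qed

lemma deviation_nonneg:
  fixes A :: "real^'m^'m"
  assumes "subspace Z"
  shows "0 \<le> deviation (ball_image_transpose A) Z"
  using deviation_upper[OF assms, of 0 A] infdist_nonneg[of "transpose A *v 0" Z] by simp

text \<open>Duality: paired with the unit vector \<open>x\<close> along \<open>A *v w\<close>, the
  norm becomes the inner product of \<open>transpose A *v x\<close> with \<open>w\<close>. Only the
  component \<open>q\<close> orthogonal to \<open>Z\<close> contributes, and its length is the
  distance to \<open>Z\<close>.\<close>

lemma norm_mult_le_deviation:
  fixes A :: "real^'m^'m"
  assumes "subspace Z" and w: "\<And>z. z \<in> Z \<Longrightarrow> orthogonal z w"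
  shows "norm (A *v w) \<le> deviation (ball_image_transpose A) Z * norm w"
proof (cases "A *v w = 0")
  case True
  then show ?thesis using deviation_nonneg[OF assms(1)] by simp
next
  case False
  define x where "x = (A *v w) /\<^sub>R norm (A *v w)"
  obtain p q where pq: "p \<in> Z" "\<And>z. z \<in> Z \<Longrightarrow> orthogonal q z" "transpose A *v x = p + q"
    using orthogonal_decomposition[OF assms(1)] by metis
  have "norm (A *v w) = x \<bullet> (A *v w)"
    using False by (simp add: x_def dot_square_norm power2_eq_square)
  also have "\<dots> = (p + q) \<bullet> w"
    by (metis dot_lmul_matrix pq(3) transpose_matrix_vector)
  also have "\<dots> = q \<bullet> w" using w[OF pq(1)] by (simp add: inner_add_left orthogonal_def)
  also have "\<dots> \<le> norm q * norm w" by (rule norm_cauchy_schwarz)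
  also have "norm q = infdist (transpose A *v x) Z"
    using infdist_subspace[OF pq(1) assms(1) pq(2)] pq(3) by simp
  also have "\<dots> \<le> deviation (ball_image_transpose A) Z"
    using False by (intro deviation_upper assms(1)) (simp add: x_def)
  finally show ?thesis by (simp add: mult_right_mono)
qed

text \<open>The converse bound: the component \<open>q\<close> of \<open>transpose A *v x\<close>
  orthogonal to \<open>Z\<close> has squared length \<open>x \<bullet> (A *v q)\<close>, at most
  \<open>c * norm q\<close>, and \<open>norm q\<close> cancels.\<close>

lemma deviation_le:
  fixes A :: "real^'m^'m"
  assumes "subspace Z" "0 \<le> c"
    and "\<And>w. (\<And>z. z \<in> Z \<Longrightarrow> orthogonal z w) \<Longrightarrow> norm (A *v w) \<le> c * norm w"
  shows "deviation (ball_image_transpose A) Z \<le> c"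
proof -
  have "infdist (transpose A *v x) Z \<le> c" if "norm x \<le> 1" for x
  proof -
    obtain p q where pq: "p \<in> Z" "\<And>z. z \<in> Z \<Longrightarrow> orthogonal q z" "transpose A *v x = p + q"
      using orthogonal_decomposition[OF assms(1)] by metis
    have "norm q * norm q = (p + q) \<bullet> q"
      using pq(2)[OF pq(1)]
      by (simp add: inner_add_left orthogonal_def inner_commute[of p q] norm_eq_sqrt_inner)
    also have "\<dots> = x \<bullet> (A *v q)"
      by (metis dot_lmul_matrix pq(3) transpose_matrix_vector)
    also have "\<dots> \<le> norm x * norm (A *v q)" by (rule norm_cauchy_schwarz)
    also have "\<dots> \<le> 1 * (c * norm q)"
      using that pq(2) by (intro mult_mono assms(3)) (auto simp: orthogonal_commute)
    finally have "norm q \<le> c" using assms(2) by (cases "q = 0") auto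
    then show ?thesis using infdist_subspace[OF pq(1) assms(1) pq(2)] pq(3) by simp
  qed
  then show ?thesis
    using subspace_0[OF assms(1)] by (subst deviation_eq_infdist) (auto intro!: cSUP_least)
qed

text \<open>The error matrix vanishes on the span and agrees with \<open>A\<close> on its
  complement, so the two preceding bounds give both inequalities.\<close>

lemma onorm_projection_error:
  fixes A :: "real^'m^'m"
  assumes "orthonormal_on {1..n} y"
  shows "onorm ((*v) (A - projected_matrix A y n))
    = deviation (ball_image_transpose A) (span (y ` {1..n}))" (is "?L = deviation ?S ?Y")
proof (rule antisym)
  show "?L \<le> deviation ?S ?Y"
  proof (rule onorm_bound)
    fix w
    obtain p q where pq: "p \<in> ?Y" "\<And>z. z \<in> ?Y \<Longrightarrow> orthogonal q z" "w = p + q"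
      using orthogonal_decomposition[OF subspace_span] by metis
    have "(A - projected_matrix A y n) *v w = A *v q"
      using projected_matrix_on_span[OF assms pq(1), of A] projected_matrix_orthogonal[of y n q A] pq(2,3)
      by (simp add: matrix_vector_mult_diff_rdistrib matrix_vector_right_distrib orthogonal_commute)
    moreover have "norm (A *v q) \<le> deviation ?S ?Y * norm q"
      using pq(2) by (intro norm_mult_le_deviation subspace_span) (simp add: orthogonal_commute)
    moreover have "norm q \<le> norm w"
    proof -
      have "(norm w)\<^sup>2 = (norm p)\<^sup>2 + (norm q)\<^sup>2"
        unfolding pq(3) using pq(1,2) by (intro norm_add_Pythagorean) (simp add: orthogonal_commute)
      then have "(norm q)\<^sup>2 \<le> (norm w)\<^sup>2" by simp
      then show ?thesis by (simp add: power2_le_iff_abs_le)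
    qed
    ultimately show "norm ((A - projected_matrix A y n) *v w) \<le> deviation ?S ?Y * norm w"
      using mult_left_mono[OF _ deviation_nonneg[OF subspace_span]] by (metis order_trans)
  qed (simp add: deviation_nonneg)
  show "deviation ?S ?Y \<le> ?L"
  proof (rule deviation_le)
    fix w assume "\<And>z. z \<in> ?Y \<Longrightarrow> orthogonal z w"
    from projected_matrix_orthogonal[OF this] have "A *v w = (A - projected_matrix A y n) *v w"
      by (simp add: matrix_vector_mult_diff_rdistrib)
    then show "norm (A *v w) \<le> ?L * norm w"
      by (metis onorm matrix_vector_mul_bounded_linear)
  qed (simp_all add: onorm_pos_le)
qed

text \<open>Turns a competing matrix into a competing subspace: vectors orthogonal to the rows of
  \<open>B\<close> lie in its kernel.\<close>

lemma deviation_row_space_le: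
  fixes A B :: "real^'m^'m"
  shows "deviation (ball_image_transpose A) (span (rows B)) \<le> onorm ((*v) (A - B))"
proof (rule deviation_le)
  fix w assume w: "\<And>z. z \<in> span (rows B) \<Longrightarrow> orthogonal z w"
  have "B *v w = 0"
    using w by (auto simp: vec_eq_iff matrix_vector_mul_component orthogonal_def rows_def row_def
        span_base intro!: w[unfolded orthogonal_def] span_base)
  then have "A *v w = (A - B) *v w" by (simp add: matrix_vector_mult_diff_rdistrib)
  then show "norm (A *v w) \<le> onorm ((*v) (A - B)) * norm w"
    by (metis onorm matrix_vector_mul_bounded_linear)
qed (simp_all add: onorm_pos_le)

section \<open>Singular value bounds for deviations\<close>

context singular_basis
begin

lemma norm_expansions:
  assumes "I \<subseteq> {1..CARD('m)}" "w \<in> span (e ` I)"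
  shows "(norm w)\<^sup>2 = (\<Sum>i\<in>I. (e i \<bullet> w)\<^sup>2)"
    and "(norm (A *v w))\<^sup>2 = (\<Sum>i\<in>I. (singular_value A i)\<^sup>2 * (e i \<bullet> w)\<^sup>2)"
proof -
  have fin: "finite I" using assms(1) finite_subset by blast
  have orth: "orthonormal_on I e" using orthonormal assms(1) by (rule orthonormal_on_subset)
  define c where "c i = e i \<bullet> w" for i
  have w: "w = (\<Sum>i\<in>I. c i *\<^sub>R e i)"
    unfolding c_def by (rule orthonormal_coefficients[OF fin orth assms(2)])
  have "w \<bullet> w = (\<Sum>i\<in>I. 1 * (c i)\<^sup>2)"
    unfolding w by (rule inner_orthonormal_sums[OF fin orthonormal_onD[OF orth]])
  then show "(norm w)\<^sup>2 = (\<Sum>i\<in>I. (e i \<bullet> w)\<^sup>2)" by (simp add: c_def dot_square_norm)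
  have "(norm (A *v w))\<^sup>2 = ((transpose A ** A) *v w) \<bullet> w"
    by (simp add: inner_matrix_vector_mult[symmetric] dot_square_norm)
  also have "\<dots> = (\<Sum>i\<in>I. c i *\<^sub>R ((transpose A ** A) *v e i)) \<bullet> (\<Sum>i\<in>I. c i *\<^sub>R e i)"
    by (simp add: w linear_sum[OF matrix_vector_mul_linear] matrix_vector_mult_scaleR)
  also have "\<dots> = (\<Sum>i\<in>I. (singular_value A i)\<^sup>2 * (c i)\<^sup>2)"
  proof (rule inner_orthonormal_sums[OF fin])
    fix i j assume "i \<in> I" "j \<in> I"
    then show "((transpose A ** A) *v e i) \<bullet> e j = (if i = j then (singular_value A i)\<^sup>2 else 0)"
      using assms(1) eigenvector[of i] orthonormal_onD[OF orth, of i j] by auto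
  qed
  finally show "(norm (A *v w))\<^sup>2 = (\<Sum>i\<in>I. (singular_value A i)\<^sup>2 * (e i \<bullet> w)\<^sup>2)"
    by (simp add: c_def)
qed

lemma span_basis: "span (e ` {1..CARD('m)}) = UNIV"
  by (metis dim_span_orthonormal[OF orthonormal] card_atLeastAtMost diff_Suc_1 dim_eq_full
      DIM_cart DIM_real mult.right_neutral span_span)

lemma norm_mult_ge:
  assumes "k \<in> {1..CARD('m)}" "w \<in> span (e ` {1..k})"
  shows "singular_value A k * norm w \<le> norm (A *v w)"
proof (rule power2_le_imp_le)
  have I: "{1..k} \<subseteq> {1..CARD('m)}" using assms(1) by auto
  have "(singular_value A k * norm w)\<^sup>2 = (\<Sum>i\<in>{1..k}. (singular_value A k)\<^sup>2 * (e i \<bullet> w)\<^sup>2)"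
    by (simp add: power_mult_distrib norm_expansions(1)[OF I assms(2)] sum_distrib_left)
  also have "\<dots> \<le> (norm (A *v w))\<^sup>2"
    unfolding norm_expansions(2)[OF I assms(2)]
    using assms(1) by (intro sum_mono mult_right_mono power_mono singular_antimono singular_nonneg) auto
  finally show "(singular_value A k * norm w)\<^sup>2 \<le> (norm (A *v w))\<^sup>2" .
qed simp

text \<open>By dimension, \<open>U\<close> shares a nonzero vector with the span of the first
  \<open>k\<close> right singular vectors, where \<open>A\<close> stretches by at least
  \<open>singular_value A k\<close>.\<close>

lemma singular_value_le:
  assumes "subspace U" "k \<in> {1..CARD('m)}" "CARD('m) < dim U + k"
    and "\<And>u. u \<in> U \<Longrightarrow> norm (A *v u) \<le> c * norm u"
  shows "singular_value A k \<le> c"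
proof -
  have "dim (span (e ` {1..k})) = k"
    using dim_span_orthonormal[OF orthonormal_on_subset[OF orthonormal, of "{1..k}"]] assms(2) by simp
  then obtain w where w: "w \<in> U" "w \<in> span (e ` {1..k})" "w \<noteq> 0"
    using subspace_nontrivial_Int[OF assms(1) subspace_span] assms(3) by (metis DIM_cart DIM_real mult.right_neutral)
  have "singular_value A k * norm w \<le> c * norm w"
    using norm_mult_ge[OF assms(2) w(2)] assms(4)[OF w(1)] by simp
  then show ?thesis using w(3) by simp
qed

text \<open>The complement of \<open>Z\<close> has dimension \<open>CARD('m) - k\<close>, so
  \<open>Suc k\<close> is the first index for which the dimension count succeeds.\<close>

lemma singular_value_le_deviation:
  assumes "subspace Z" "dim Z = k" "k < CARD('m)"
  shows "singular_value A (Suc k) \<le> deviation (ball_image_transpose A) Z"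
proof (rule singular_value_le)
  show "subspace {w. \<forall>z\<in>Z. orthogonal z w}"
    by (auto simp: subspace_def orthogonal_def inner_add_right)
  show "CARD('m) < dim {w. \<forall>z\<in>Z. orthogonal z w} + Suc k"
    using dim_orthogonal_complement[OF assms(1)] assms(2) by simp
qed (use assms in \<open>auto intro: norm_mult_le_deviation\<close>)

text \<open>A vector orthogonal to \<open>e 1, ..., e k\<close> has only coefficients whose singular
  values are at most the one of index \<open>Suc k\<close>.\<close>

lemma deviation_leading_span:
  assumes "k < CARD('m)"
  shows "deviation (ball_image_transpose A) (span (e ` {1..k})) \<le> singular_value A (Suc k)"
proof (rule deviation_le)
  show nonneg: "0 \<le> singular_value A (Suc k)" using assms by (intro singular_nonneg) auto
  fix w assume w: "\<And>z. z \<in> span (e ` {1..k}) \<Longrightarrow> orthogonal z w"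
  have zero: "e i \<bullet> w = 0" if "i \<in> {1..k}" for i
    using w[of "e i"] that by (simp add: span_base orthogonal_def)
  have w_span: "w \<in> span (e ` {1..CARD('m)})" by (simp only: span_basis UNIV_I)
  show "norm (A *v w) \<le> singular_value A (Suc k) * norm w"
  proof (rule power2_le_imp_le)
    have "(singular_value A i)\<^sup>2 * (e i \<bullet> w)\<^sup>2 \<le> (singular_value A (Suc k))\<^sup>2 * (e i \<bullet> w)\<^sup>2"
      if "i \<in> {1..CARD('m)}" for i
    proof (cases "i \<le> k")
      case False
      then show ?thesis
        using that by (intro mult_right_mono power_mono singular_antimono singular_nonneg) auto
    qed (use zero that in auto)
    then show "(norm (A *v w))\<^sup>2 \<le> (singular_value A (Suc k) * norm w)\<^sup>2"
      unfolding power_mult_distrib norm_expansions[OF order_refl w_span] sum_distrib_left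
      by (rule sum_mono)
  qed (use nonneg in simp)
qed simp

text \<open>A kernel vector in \<open>Y\<close> can be added to the orthogonal complement of \<open>Y\<close> without increasing
  the norm of the restriction of \<open>A\<close>, and the larger space already meets the span of the first \<open>n\<close>
  right singular vectors.\<close>

lemma mult_nonzero_of_deviation_less:
  assumes "subspace Y" "dim Y = n" "n \<in> {1..CARD('m)}"
    and less: "deviation (ball_image_transpose A) Y < singular_value A n"
    and v: "v \<in> Y" "A *v v = 0"
  shows "v = 0"
proof (rule ccontr)
  assume "v \<noteq> 0"
  let ?d = "deviation (ball_image_transpose A) Y"
  define W where "W = {w. \<forall>z\<in>Y. orthogonal z w}"
  have W: "subspace W"
    by (auto simp: W_def subspace_def orthogonal_def inner_add_right)
  then have span_W: "span W = W" by (simp only: span_eq_iff)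
  have "v \<notin> W" using \<open>v \<noteq> 0\<close> v(1) orthogonal_self[of v] by (auto simp: W_def)
  then have "dim (span (insert v W)) = Suc (dim W)"
    by (simp add: dim_insert span_W)
  \<comment> \<open>\<open>W\<close> has dimension \<open>CARD('m) - n\<close>; the one dimension
    gained from \<open>v\<close> lowers the usable index from \<open>n + 1\<close> to
    \<open>n\<close>.\<close>
  then have dim: "CARD('m) < dim (span (insert v W)) + n"
    using dim_orthogonal_complement[OF assms(1)] assms(2) by (simp add: W_def)
  have "singular_value A n \<le> ?d"
  proof (rule singular_value_le[OF subspace_span assms(3) dim])
    fix u assume "u \<in> span (insert v W)"
    then obtain k where "u - k *\<^sub>R v \<in> span W" using span_breakdown_eq by blast
    then have w: "u - k *\<^sub>R v \<in> W" by (simp only: span_W)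
    let ?w = "u - k *\<^sub>R v"
    have "A *v u = A *v ?w"
      by (simp add: matrix_vector_mult_diff_distrib matrix_vector_mult_scaleR v(2))
    moreover have "norm (A *v ?w) \<le> ?d * norm ?w"
      using w by (intro norm_mult_le_deviation assms(1)) (simp add: W_def)
    moreover have "norm ?w \<le> norm u"
    proof -
      have "orthogonal (k *\<^sub>R v) ?w" using w v(1) by (simp add: W_def orthogonal_def)
      then have "(norm (k *\<^sub>R v + ?w))\<^sup>2 = (norm (k *\<^sub>R v))\<^sup>2 + (norm ?w)\<^sup>2"
        by (rule norm_add_Pythagorean)
      then have "(norm ?w)\<^sup>2 \<le> (norm u)\<^sup>2" by simp
      then show ?thesis by (simp add: power2_le_iff_abs_le)
    qed
    ultimately show "norm (A *v u) \<le> ?d * norm u"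
      using mult_left_mono[OF _ deviation_nonneg[OF assms(1)]] by (metis order_trans)
  qed
  with less show False by simp
qed

end

section \<open>Optimal subspaces and best approximations\<close>

text \<open>Deviations are bounded below by 0, so the infimum is a true lower bound, and a minimal
  \<open>Y\<close> attains it. Optimality becomes a pairwise comparison.\<close>

lemma optimal_subspace_iff:
  fixes A :: "real^'m^'m"
  assumes "subspace Y" "dim Y = n"
  shows "optimal_subspace n (ball_image_transpose A) Y \<longleftrightarrow>
    (\<forall>Z. subspace Z \<and> dim Z = n \<longrightarrow>
      deviation (ball_image_transpose A) Y \<le> deviation (ball_image_transpose A) Z)"
    (is "_ \<longleftrightarrow> (\<forall>Z. ?Q Z \<longrightarrow> ?d Y \<le> ?d Z)")
proof
  have bdd: "bdd_below (?d ` {Z. ?Q Z})"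
    by (rule bdd_belowI[of _ 0]) (auto intro: deviation_nonneg)
  {
    assume "optimal_subspace n (ball_image_transpose A) Y"
    then show "\<forall>Z. ?Q Z \<longrightarrow> ?d Y \<le> ?d Z"
      using cINF_lower[OF bdd] by (auto simp: optimal_subspace_def kolmogorov_width_def)
  next
    assume "\<forall>Z. ?Q Z \<longrightarrow> ?d Y \<le> ?d Z"
    then have "kolmogorov_width n (ball_image_transpose A) = ?d Y"
      unfolding kolmogorov_width_def using assms by (intro cInf_eq_minimum) auto
    then show "optimal_subspace n (ball_image_transpose A) Y"
      using assms by (simp add: optimal_subspace_def)
  }
qed

theorem theorem2:
  fixes A :: "real^'m^'m" and r n :: nat and x y :: "nat \<Rightarrow> real^'m"
  assumes rank_A: "rank A = r"
    and n: "1 \<le> n" "n \<le> CARD('m)"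
    and orthonormal: "\<And>i j. i \<in> {1..n} \<Longrightarrow> j \<in> {1..n} \<Longrightarrow> y i \<bullet> y j = (if i = j then 1 else 0)"
    and x: "\<And>i. i \<in> {1..n} \<Longrightarrow> x i = A *v y i"
  defines "Y \<equiv> span (y ` {1..n})"
  shows "onorm ((*v) (A - (\<Sum>i=1..n. outer_product (x i) (y i)))) = deviation (ball_image_transpose A) Y
    \<and> (n < r \<and> singular_value A n > singular_value A (n + 1)
         \<and> singular_value A (n + 1) > singular_value A (n + 2) \<and> singular_value A (n + 2) \<ge> 0
       \<longrightarrow> (best_rank_approx n A (\<Sum>i=1..n. outer_product (x i) (y i))
            \<longleftrightarrow> optimal_subspace n (ball_image_transpose A) Y))"
proof -
  let ?d = "deviation (ball_image_transpose A)"
  have y: "orthonormal_on {1..n} y" using orthonormal by (simp add: orthonormal_on_def)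
  have R: "(\<Sum>i=1..n. outer_product (x i) (y i)) = projected_matrix A y n"
    using x by (simp add: projected_matrix_def)
  have Y: "subspace Y" "dim Y = n"
    using dim_span_orthonormal[OF y] by (simp_all add: Y_def)
  have error: "onorm ((*v) (A - projected_matrix A y n)) = ?d Y"
    unfolding Y_def by (rule onorm_projection_error[OF y])
  have "best_rank_approx n A (projected_matrix A y n) \<longleftrightarrow> optimal_subspace n (ball_image_transpose A) Y"
    if "n < r" and gap: "singular_value A n > singular_value A (n + 1)"
  proof -
    \<comment> \<open>This makes \<open>n + 1\<close> a valid index of the singular basis.\<close>
    have n_less: "n < CARD('m)" using that(1) rank_A rank_bound[of A] by simp
    obtain e where "singular_basis A e" by (rule singular_basis_exists)
    then interpret singular_basis A e .
    have e: "orthonormal_on {1..n} e"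
      using orthonormal_on_subset[OF singular_basis.orthonormal[OF \<open>singular_basis A e\<close>]] n(2) by auto
    let ?Z = "span (e ` {1..n})"
    have Z: "?d ?Z \<le> singular_value A (n + 1)"
      using deviation_leading_span[OF n_less] by simp
    show ?thesis
    proof
      assume best: "best_rank_approx n A (projected_matrix A y n)"
      \<comment> \<open>By the gap, \<open>?Z\<close> has deviation below
        \<open>singular_value A n\<close>, so \<open>A\<close> is injective on it and its projected
        matrix is an admissible competitor.\<close>
      have "rank (projected_matrix A e n) = n"
        using mult_nonzero_of_deviation_less[OF subspace_span _ _ le_less_trans[OF Z gap]]
          dim_span_orthonormal[OF e] n
        by (intro rank_projected_matrix[OF e]) auto
      then have "?d Y \<le> ?d ?Z"
        using best onorm_projection_error[OF e, of A] error by (auto simp: best_rank_approx_def)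
      then have "?d Y \<le> ?d Z'" if "subspace Z'" "dim Z' = n" for Z'
        using Z singular_value_le_deviation[OF that n_less] by simp
      then show "optimal_subspace n (ball_image_transpose A) Y"
        using optimal_subspace_iff[OF Y] by blast
    next
      assume "optimal_subspace n (ball_image_transpose A) Y"
      then have opt: "\<And>Z. subspace Z \<Longrightarrow> dim Z = n \<Longrightarrow> ?d Y \<le> ?d Z"
        using optimal_subspace_iff[OF Y] by blast
      \<comment> \<open>Comparison with \<open>?Z\<close> puts the deviation of \<open>Y\<close>
        below the gap, which secures rank \<open>n\<close> for the given matrix.\<close>
      have "?d Y \<le> ?d ?Z" using dim_span_orthonormal[OF e] by (intro opt) auto
      with Z gap have less: "?d Y < singular_value A n" by simp
      have "rank (projected_matrix A y n) = n"
        using mult_nonzero_of_deviation_less[OF Y _ less] n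
        by (intro rank_projected_matrix[OF y]) (auto simp: Y_def)
      \<comment> \<open>The row space of \<open>B\<close> has dimension \<open>n\<close>, so
        optimality of \<open>Y\<close> applies to it.\<close>
      moreover have "?d Y \<le> onorm ((*v) (A - B))" if "rank B = n" for B
        using opt[of "span (rows B)"] that deviation_row_space_le[of A B]
        by (simp add: row_rank_def)
      ultimately show "best_rank_approx n A (projected_matrix A y n)"
        by (simp add: best_rank_approx_def error)
    qed
  qed
  then show ?thesis unfolding R error by blast
qed

end
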